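(* For an integer $n>1$ and a real number $\alpha$ with $1\le\alpha\le\sqrt n$ let $$g(n,\alpha)=\frac1\alpha\sqrt n\,\log n+2\left(1+\frac{0.6}{\alpha}\right)\sqrt n+\frac{2(2n-1)\alpha}{2\sqrt n-\alpha}.$$ Then for every $\varepsilon>0$ there is a constant $C_\varepsilon$, depending only on $\varepsilon$, such that for all integers $n>1$ and all real $\alpha$ with $1\le\alpha\le\sqrt n$: if $n$ is not a square, $$f(n)\le\frac12\theta(n)g(n,\alpha)\le C_\varepsilon n^{\varepsilon}\left(\frac1{2\alpha}\sqrt n\,\log n+\left(1+\frac{0.6}{\alpha}\right)\sqrt n+\frac{(2n-1)\alpha}{2\sqrt n-\alpha}\right);$$ if $n$ is a square, $$f(n)\le\frac12(\theta(n)+1)g(n,\alpha)\le (C_\varepsilon n^{\varepsilon}+1)\left(\frac1{2\alpha}\sqrt n\,\log n+\left(1+\frac{0.6}{\alpha}\right)\sqrt n+\frac{(2n-1)\alpha}{2\sqrt n-\alpha}\right).$$ In particular, $f(n)<n$ for all sufficiently large $n$.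
   Context: For an integer $n>1$, consider the equation $$n=\left(X+\frac1x\right)\left(Y+\frac1y\right)$$ in positive integers $X,x,Y,y$ with $x>1$ and $y>1$. Two solutions obtained from each other by transposing the pairs $(X,x)$ and $(Y,y)$ are identified, and $f(n)$ denotes the number of solutions up to this identification. Since $x\neq y$ in every solution, $f(n)$ is equivalently the number of quadruples $(X,x,Y,y)$ of positive integers satisfying the equation with $1<x<y$. $\theta(n)$ is the number of positive divisors of $n$, and $\log$ is the natural logarithm. *)

theory Defs
  imports Complex_Main "HOL-Computational_Algebra.Nth_Powers"
begin

definition solutions :: "nat \<Rightarrow> (nat \<times> nat \<times> nat \<times> nat) set" where
  "solutions n = {(X, x, Y, y). X > 0 \<and> x > 1 \<and> Y > 0 \<and> y > 1 \<and>
     real n = (real X + 1 / real x) * (real Y + 1 / real y)}"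

fun transpose_pairs :: "nat \<times> nat \<times> nat \<times> nat \<Rightarrow> nat \<times> nat \<times> nat \<times> nat" where
  "transpose_pairs (X, x, Y, y) = (Y, y, X, x)"

definition same_solution ::
    "nat \<Rightarrow> ((nat \<times> nat \<times> nat \<times> nat) \<times> (nat \<times> nat \<times> nat \<times> nat)) set" where
  "same_solution n = {(s, t). s \<in> solutions n \<and> t \<in> solutions n \<and> (t = s \<or> t = transpose_pairs s)}"

text \<open>The quotient is finite (see \<open>finite_solutions\<close> below), so the cardinality is genuine.\<close>

definition f :: "nat \<Rightarrow> nat" where
  "f n = card (solutions n // same_solution n)"

definition \<theta> :: "nat \<Rightarrow> nat" where
  "\<theta> n = card {d. d dvd n}"

definition g :: "nat \<Rightarrow> real \<Rightarrow> real" where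
  "g n \<alpha> = 1 / \<alpha> * sqrt n * ln n + 2 * (1 + 0.6 / \<alpha>) * sqrt n
            + 2 * (2 * real n - 1) * \<alpha> / (2 * sqrt n - \<alpha>)"

lemma transpose_pairs_transpose_pairs [simp]: "transpose_pairs (transpose_pairs s) = s"
  by (cases s) simp

lemma transpose_pairs_in_solutions [simp]:
  "transpose_pairs s \<in> solutions n \<longleftrightarrow> s \<in> solutions n"
  by (cases s) (auto simp: solutions_def mult.commute)

lemma equiv_same_solution: "equiv (solutions n) (same_solution n)"
  by (rule equivI) (auto simp: same_solution_def refl_on_def sym_def trans_def)

lemma solutions_nat_eq:
  assumes "(X, x, Y, y) \<in> solutions n"
  shows   "n * (x * y) = (X * x + 1) * (Y * y + 1)"
proof -
  have *: "x > 1" "y > 1" "real n = (real X + 1 / real x) * (real Y + 1 / real y)"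
    using assms by (auto simp: solutions_def)
  have "real (n * (x * y)) = real ((X * x + 1) * (Y * y + 1))"
    unfolding of_nat_mult *(3) using *(1,2) by (simp add: field_simps)
  thus ?thesis
    by (simp only: of_nat_eq_iff)
qed

lemma solutions_neq:
  assumes "(X, x, Y, y) \<in> solutions n"
  shows   "x \<noteq> y"
proof
  assume "x = y"
  hence "n * x * x = (X * Y * x + X + Y) * x + 1"
    using solutions_nat_eq[OF assms] by (simp add: algebra_simps)
  moreover have "x dvd n * x * x" "x dvd (X * Y * x + X + Y) * x"
    by simp_all
  ultimately have "x dvd 1"
    by (metis dvd_add_right_iff)
  thus False
    using assms by (auto simp: solutions_def)
qed

lemma solutions_bound:
  assumes "(X, x, Y, y) \<in> solutions n" "x < y"
  shows   "X \<le> n" "Y \<le> n" "x \<le> 2 * n + 1" "y \<le> n * (2 * n + 1) + 1"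
proof -
  have pos: "X > 0" "x > 1" "Y > 0" "y > 1"
    using assms(1) by (auto simp: solutions_def)
  have eq: "n * (x * y) = X * Y * (x * y) + (X * x + Y * y + 1)"
    using solutions_nat_eq[OF assms(1)] by (simp add: algebra_simps)
  hence "X * Y * (x * y) < n * (x * y)"
    by simp
  hence XY: "X * Y < n"
    by simp
  define m where "m = n - X * Y"
  have m: "m > 0" "n = X * Y + m"
    using XY by (simp_all add: m_def)
  have eq': "m * x * y = X * x + Y * y + 1"
    using eq by (simp add: m(2) algebra_simps)
  show X: "X \<le> n"
    using XY pos by (metis One_nat_def Suc_leI le_trans less_imp_le mult.right_neutral mult_le_mono2)
  show Y: "Y \<le> n"
    using XY pos by (metis One_nat_def Suc_leI le_trans less_imp_le mult.left_neutral mult_le_mono1)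
  have "X * x \<le> X * y"
    using assms(2) by simp
  hence "m * x * y \<le> (X + Y + 1) * y"
    unfolding eq' add_mult_distrib using pos by linarith
  hence "m * x \<le> X + Y + 1"
    using pos(4) by (metis mult_le_cancel2 less_trans zero_less_one)
  moreover have "x \<le> m * x"
    using m(1) by simp
  ultimately show x: "x \<le> 2 * n + 1"
    using X Y by linarith
  have "Y * y < (m * x) * y"
    unfolding eq' by simp
  hence "Y + 1 \<le> m * x"
    by simp
  hence "(Y + 1) * y \<le> m * x * y"
    by (rule mult_le_mono1)
  hence "y \<le> X * x + 1"
    unfolding eq' by simp
  also have "\<dots> \<le> n * (2 * n + 1) + 1"
    using X x by (intro add_mono mult_le_mono) auto
  finally show "y \<le> n * (2 * n + 1) + 1" .
qed

lemma finite_solutions: "finite (solutions n)"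
proof -
  define B where "B = n * (2 * n + 1) + 2 * n + 1"
  have "solutions n \<subseteq> {..B} \<times> {..B} \<times> {..B} \<times> {..B}"
  proof (clarify, goal_cases)
    case (1 X x Y y)
    consider "x < y" | "y < x"
      using solutions_neq[OF 1] by linarith
    thus ?case
    proof cases
      case 1
      thus ?thesis
        using solutions_bound[OF \<open>(X, x, Y, y) \<in> solutions n\<close> 1] by (auto simp: B_def)
    next
      case 2
      have "(Y, y, X, x) \<in> solutions n"
        using 1 transpose_pairs_in_solutions[of "(X, x, Y, y)" n] by simp
      from solutions_bound[OF this 2] show ?thesis
        by (auto simp: B_def)
    qed
  qed
  thus ?thesis
    by (rule finite_subset) auto
qed

lemma f_eq_card_ordered:
  "f n = card {(X, x, Y, y). (X, x, Y, y) \<in> solutions n \<and> x < y}" (is "_ = card ?S")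
proof -
  have cls: "same_solution n `` {s} = {s, transpose_pairs s}" if "s \<in> solutions n" for s
    using that by (auto simp: same_solution_def)
  have "bij_betw (\<lambda>s. same_solution n `` {s}) ?S (solutions n // same_solution n)"
    unfolding bij_betw_def
  proof
    show "inj_on (\<lambda>s. same_solution n `` {s}) ?S"
      by (rule inj_onI) (auto simp: cls doubleton_eq_iff)
    show "(\<lambda>s. same_solution n `` {s}) ` ?S = solutions n // same_solution n"
    proof (intro equalityI subsetI)
      fix c assume "c \<in> solutions n // same_solution n"
      then obtain X x Y y where s: "(X, x, Y, y) \<in> solutions n"
          and c: "c = {(X, x, Y, y), (Y, y, X, x)}"
        by (auto elim!: quotientE simp: cls)
      have s': "(Y, y, X, x) \<in> solutions n"
        using s transpose_pairs_in_solutions[of "(X, x, Y, y)" n] by simp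
      consider "x < y" | "y < x"
        using solutions_neq[OF s] by linarith
      thus "c \<in> (\<lambda>s. same_solution n `` {s}) ` ?S"
      proof cases
        case 1
        thus ?thesis
          using s c by (intro image_eqI[of _ _ "(X, x, Y, y)"]) (auto simp: cls)
      next
        case 2
        thus ?thesis
          using s' c by (intro image_eqI[of _ _ "(Y, y, X, x)"]) (auto simp: cls)
      qed
    qed (auto intro: quotientI)
  qed
  thus ?thesis
    by (simp add: f_def bij_betw_same_card)
qed

end

theory Submission
  imports Defs "HOL-Analysis.Harmonic_Numbers"
begin

text \<open>
  In a solution \<open>x\<close> divides \<open>Y y + 1\<close> and \<open>y\<close> divides \<open>X x + 1\<close>, so \<open>a x = Y y + 1\<close> and
  \<open>b y = X x + 1\<close> with \<open>a b = n\<close>. Put \<open>m = n - X Y\<close>; then \<open>m y = X + a\<close>. Since \<open>X Y < n\<close> we may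
  transpose so that \<open>X\<^sup>2 < n\<close>. For fixed \<open>a\<close> and \<open>X\<close>, both \<open>y\<close> and \<open>m\<close> are determined modulo \<open>X\<close>, while
  \<open>X\<close> is determined modulo \<open>y\<close> (given \<open>y\<close>) and modulo \<open>m\<close> (given \<open>m\<close>). So \<open>X\<close> determines the
  solutions with \<open>m \<le> X\<close> and those with \<open>y \<le> X\<close>, and in the remaining ones either of \<open>y\<close> and \<open>m\<close>
  determines the solution, where one of them is at most \<open>sqrt (a + sqrt n)\<close>. Adding the counts for
  \<open>a\<close> and \<open>n / a\<close> gives at most \<open>6.5 sqrt n - 2.5\<close>, which is below \<open>g n \<alpha>\<close> for every \<open>\<alpha> \<ge> 1\<close>.
\<close>

subsection \<open>The divisor bound\<close>

text \<open>Multiplication maps pairs of divisors of \<open>m\<close> and \<open>n\<close> onto the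
  divisors of \<open>m * n\<close>. For non-coprime arguments it is not injective, hence only an
  inequality.\<close>

lemma \<theta>_mult_le:
  assumes "m > 0" "n > 0"
  shows   "\<theta> (m * n) \<le> \<theta> m * \<theta> n"
proof -
  have "{d. d dvd m * n} \<subseteq> (\<lambda>(a, b). a * b) ` ({d. d dvd m} \<times> {d. d dvd n})"
    by (auto simp: image_iff dest!: division_decomp)
  hence "card {d. d dvd m * n} \<le> card ({d. d dvd m} \<times> {d. d dvd n})"
    using assms by (intro surj_card_le) auto
  thus ?thesis
    by (simp add: \<theta>_def card_cartesian_product)
qed

lemma \<theta>_prime_power:
  assumes "prime p"
  shows   "\<theta> (p ^ e) = e + 1"
proof -
  have "{d. d dvd p ^ e} = (\<lambda>i. p ^ i) ` {..e}"
    using assms by (auto simp: divides_primepow_nat le_imp_power_dvd)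
  moreover have "inj_on (\<lambda>i. p ^ i) {..e}"
    using prime_gt_1_nat[OF assms] by (auto intro!: inj_onI)
  ultimately show ?thesis
    by (simp add: \<theta>_def card_image)
qed

text \<open>Each prime factor \<open>p\<close> that is split off at most halves
  \<open>\<theta>\<close>, while it divides \<open>n powr \<epsilon>\<close> by
  \<open>p powr \<epsilon> \<ge> 2\<close>; so no constant is lost.\<close>

lemma \<theta>_le_powr_rough:
  fixes \<epsilon> :: real
  assumes "\<epsilon> > 0" "n > 0" "\<And>p. prime p \<Longrightarrow> p dvd n \<Longrightarrow> 2 \<le> real p powr \<epsilon>"
  shows   "real (\<theta> n) \<le> real n powr \<epsilon>"
  using assms(2,3)
proof (induction n rule: less_induct)
  case (less n)
  show ?case
  proof (cases "n = 1")
    case True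
    thus ?thesis by (simp add: \<theta>_def)
  next
    case False
    then obtain p where p: "prime p" "p dvd n"
      using prime_factor_nat by blast
    then obtain k where k: "n = p * k" by blast
    have pos: "k > 0" "p > 0" using less.prems k by auto
    have "k < n" using k pos prime_gt_1_nat[OF p(1)] by simp
    hence IH: "real (\<theta> k) \<le> real k powr \<epsilon>"
      using less k pos by (metis dvd_mult)
    have "real (\<theta> n) \<le> real (\<theta> p) * real (\<theta> k)"
      using \<theta>_mult_le[OF pos(2,1)] k by (metis of_nat_le_iff of_nat_mult)
    also have "real (\<theta> p) = 2"
      using \<theta>_prime_power[OF p(1), of 1] by simp
    also have "2 * real (\<theta> k) \<le> real p powr \<epsilon> * real k powr \<epsilon>"
      using less.prems(2)[OF p] IH by (intro mult_mono) auto
    also have "\<dots> = real n powr \<epsilon>"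
      by (simp add: k powr_mult)
    finally show ?thesis .
  qed
qed

text \<open>This is \<open>1 + z \<le> exp z\<close> with \<open>z = \<epsilon> * ln p * e\<close>.
  The point is that \<open>c\<close> depends on \<open>\<epsilon>\<close> alone, not on
  \<open>p\<close> or \<open>e\<close>.\<close>

lemma Suc_le_const_mult_powr:
  fixes \<epsilon> p :: real
  assumes "\<epsilon> > 0" "p \<ge> 2"
  defines "c \<equiv> min 1 (\<epsilon> * ln 2)"
  shows   "c > 0" "real e + 1 \<le> 1 / c * (p ^ e) powr \<epsilon>"
proof -
  show c: "c > 0"
    using assms by (simp add: c_def)
  have "c * (real e + 1) = c * real e + c"
    by (simp add: algebra_simps)
  also have "\<dots> \<le> \<epsilon> * ln 2 * real e + 1"
    by (intro add_mono mult_right_mono) (auto simp: c_def)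
  also have "\<epsilon> * ln 2 * real e \<le> \<epsilon> * ln p * real e"
    using assms by (intro mult_right_mono mult_left_mono) auto
  also have "\<epsilon> * ln p * real e + 1 \<le> exp (\<epsilon> * ln p * real e)"
    using exp_ge_add_one_self[of "\<epsilon> * ln p * real e"] by linarith
  also have "\<dots> = (p ^ e) powr \<epsilon>"
    using assms by (simp add: powr_def ln_realpow algebra_simps)
  finally show "real e + 1 \<le> 1 / c * (p ^ e) powr \<epsilon>"
    using c by (simp add: field_simps)
qed

lemma \<theta>_le_powr:
  fixes \<epsilon> :: real
  assumes "\<epsilon> > 0"
  shows   "\<exists>C>0. \<forall>n>0. real (\<theta> n) \<le> C * real n powr \<epsilon>"
proof -
  \<comment> \<open>Primes \<open>p \<ge> 2 powr (1 / \<epsilon>)\<close> cost no constant; the smaller ones are added one at a time, by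
    descending induction on the least admissible prime factor.\<close>
  define Q where "Q = (\<lambda>P::nat. \<exists>C>0. \<forall>n>0. (\<forall>p. prime p \<longrightarrow> p dvd n \<longrightarrow> P \<le> p)
      \<longrightarrow> real (\<theta> n) \<le> C * real n powr \<epsilon>)"
  define c where "c = min 1 (\<epsilon> * ln 2)"
  define P0 where "P0 = nat \<lceil>2 powr (1 / \<epsilon>)\<rceil>"
  have "Q P0"
    unfolding Q_def
  proof (intro exI[of _ 1] conjI allI impI)
    fix n :: nat assume n: "n > 0" "\<forall>p. prime p \<longrightarrow> p dvd n \<longrightarrow> P0 \<le> p"
    have "2 \<le> real p powr \<epsilon>" if "prime p" "p dvd n" for p
    proof -
      have "2 powr (1 / \<epsilon>) \<le> real p"
        using n(2) that unfolding P0_def by (meson nat_le_iff ceiling_le_iff of_int_of_nat_eq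
            order_trans le_of_int_ceiling real_nat_ceiling_ge of_nat_le_iff)
      hence "(2 powr (1 / \<epsilon>)) powr \<epsilon> \<le> real p powr \<epsilon>"
        using assms by (intro powr_mono2) auto
      thus ?thesis using assms by (simp add: powr_powr)
    qed
    thus "real (\<theta> n) \<le> 1 * real n powr \<epsilon>"
      using \<theta>_le_powr_rough[OF assms n(1)] by simp
  qed auto
  moreover have "Q P" if "Q (Suc P)" for P
  proof (cases "prime P")
    case False
    \<comment> \<open>When \<open>P\<close> is not prime, the conditions on prime factors in
      \<open>Q P\<close> and \<open>Q (Suc P)\<close> coincide.\<close>
    have "Suc P \<le> p" if "prime p" "P \<le> p" for p
      using that False by (metis Suc_leI le_neq_implies_less)
    thus ?thesis using that unfolding Q_def by meson
  next
    case True
    from \<open>Q (Suc P)\<close> obtain C where C: "C > 0" "\<And>n. n > 0 \<Longrightarrow>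
        (\<And>p. prime p \<Longrightarrow> p dvd n \<Longrightarrow> Suc P \<le> p) \<Longrightarrow> real (\<theta> n) \<le> C * real n powr \<epsilon>"
      unfolding Q_def by blast
    have P2: "real P \<ge> 2" using prime_ge_2_nat[OF True] by simp
    note c = Suc_le_const_mult_powr[OF assms P2, folded c_def]
    show ?thesis
      unfolding Q_def
    proof (intro exI[of _ "1 / c * C"] conjI allI impI)
      fix n :: nat assume n: "n > 0" "\<forall>p. prime p \<longrightarrow> p dvd n \<longrightarrow> P \<le> p"
      \<comment> \<open>Once the full power of \<open>P\<close> is removed, all prime factors of
        \<open>k\<close> exceed \<open>P\<close>, so \<open>Q (Suc P)\<close> applies to
        \<open>k\<close>; the power of \<open>P\<close> costs the factor
        \<open>1 / c\<close>.\<close>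
      obtain e k where k: "\<not> P dvd k" "n = P ^ e * k"
        using multiplicity_decompose'[of n P] n(1) True by (metis less_not_refl not_prime_unit)
      have pos: "k > 0" "P ^ e > 0" using k n by auto
      have "Suc P \<le> p" if "prime p" "p dvd k" for p
        using n(2) that k by (metis Suc_leI dvd_mult le_neq_implies_less)
      hence kb: "real (\<theta> k) \<le> C * real k powr \<epsilon>"
        using C(2) pos by blast
      have "real (\<theta> n) \<le> real (\<theta> (P ^ e)) * real (\<theta> k)"
        using \<theta>_mult_le[OF pos(2,1)] k by (metis of_nat_le_iff of_nat_mult)
      also have "\<dots> = (real e + 1) * real (\<theta> k)"
        using \<theta>_prime_power[OF True] by simp
      also have "\<dots> \<le> (1 / c * (real P ^ e) powr \<epsilon>) * (C * real k powr \<epsilon>)"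
        using c kb by (intro mult_mono) auto
      also have "\<dots> = 1 / c * C * real n powr \<epsilon>"
        by (simp add: k powr_mult)
      finally show "real (\<theta> n) \<le> 1 / c * C * real n powr \<epsilon>" .
    qed (use c C in auto)
  qed
  ultimately have "Q 0"
    using inc_induct[of 0 P0 Q] by blast
  thus ?thesis by (simp add: Q_def)
qed

subsection \<open>Solutions with a given divisor\<close>

text \<open>Here \<open>a\<close> is the quotient of \<open>Y * y + 1\<close> by \<open>x\<close>.
  The orientation of a solution is normalised by \<open>X * X < n\<close> instead of
  \<open>x < y\<close>.\<close>

definition sols_at :: "nat \<Rightarrow> nat \<Rightarrow> (nat \<times> nat \<times> nat \<times> nat) set" where
  "sols_at n a = {(X, x, Y, y). (X, x, Y, y) \<in> solutions n \<and> X * X < n \<and> a * x = Y * y + 1}"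

text \<open>The last three facts come from putting \<open>a * x\<close> for \<open>Y * y + 1\<close>
  in the cleared equation and cancelling \<open>x\<close>. As \<open>X * Y < n\<close>, the
  subtraction \<open>n - X * Y\<close> is not truncated.\<close>

lemma sols_atD:
  assumes "(X, x, Y, y) \<in> sols_at n a"
  shows   "X > 0" "x > 1" "Y > 0" "y > 1" "X * X < n" "a * x = Y * y + 1"
          "n * y = a * (X * x + 1)" "X * Y < n" "(n - X * Y) * y = X + a"
proof -
  have s: "(X, x, Y, y) \<in> solutions n"
    using assms by (auto simp: sols_at_def)
  show a: "X > 0" "x > 1" "Y > 0" "y > 1" "X * X < n" "a * x = Y * y + 1"
    using assms by (auto simp: sols_at_def solutions_def)
  have eq: "n * (x * y) = (X * x + 1) * (Y * y + 1)"
    by (rule solutions_nat_eq[OF s])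
  have "x * (n * y) = x * (a * (X * x + 1))"
    using eq a(6) by (simp add: algebra_simps)
  thus "n * y = a * (X * x + 1)"
    using a by simp
  have eq': "n * (x * y) = X * Y * (x * y) + X * x + a * x"
    unfolding eq a(6) by (simp add: algebra_simps)
  hence "X * Y * (x * y) < n * (x * y)"
    using a by simp
  thus XY: "X * Y < n"
    by simp
  have "x * ((n - X * Y) * y) = x * (X + a)"
    using eq' by (simp add: algebra_simps diff_mult_distrib diff_mult_distrib2)
  thus "(n - X * Y) * y = X + a"
    using a by simp
qed

text \<open>\<open>x\<close> is coprime to \<open>X * x + 1\<close>, so it divides the other factor
  \<open>Y * y + 1\<close>; likewise \<open>y\<close> divides \<open>X * x + 1\<close>. The product
  of the two quotients is \<open>n\<close>.\<close>

lemma ex_sols_at: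
  assumes "(X, x, Y, y) \<in> solutions n" "X * X < n"
  shows   "\<exists>a. a dvd n \<and> (X, x, Y, y) \<in> sols_at n a"
proof -
  have pos: "X > 0" "x > 1" "Y > 0" "y > 1"
    using assms by (auto simp: solutions_def)
  have eq: "n * (x * y) = (X * x + 1) * (Y * y + 1)"
    by (rule solutions_nat_eq[OF assms(1)])
  have "coprime x (X * x + 1)" "coprime y (Y * y + 1)"
    using gcd_add_mult[of x X 1] gcd_add_mult[of y Y 1] by (simp_all add: coprime_iff_gcd_eq_1)
  moreover have "x dvd (X * x + 1) * (Y * y + 1)" "y dvd (X * x + 1) * (Y * y + 1)"
    unfolding eq[symmetric] by simp_all
  ultimately have "x dvd Y * y + 1" "y dvd X * x + 1"
    by (simp_all only: coprime_dvd_mult_right_iff coprime_dvd_mult_left_iff)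
  then obtain a b where ab: "Y * y + 1 = x * a" "X * x + 1 = y * b"
    by (auto elim!: dvdE)
  have "n * (x * y) = (b * a) * (x * y)"
    unfolding eq ab by (simp add: algebra_simps)
  hence "n = b * a"
    using pos by simp
  thus ?thesis
    using assms ab by (intro exI[of _ a]) (auto simp: sols_at_def mult.commute)
qed

text \<open>\<open>n * y = a * (X * x + 1)\<close> yields \<open>x\<close>, and then
  \<open>a * x = Y * y + 1\<close> yields \<open>Y\<close>. Hence the injectivity proofs only have
  to recover \<open>X\<close> and \<open>y\<close>.\<close>

lemma sols_at_eqI:
  assumes "(X, x, Y, y) \<in> sols_at n a" "(X, x', Y', y) \<in> sols_at n a"
  shows   "x = x' \<and> Y = Y'"
proof -
  note s = sols_atD[OF assms(1)] sols_atD[OF assms(2)]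
  have "a > 0" using s(2,6) by (cases a) auto
  hence "x = x'" using s(1,7,16) by simp
  moreover from this have "Y * y = Y' * y" using s by simp
  ultimately show ?thesis using s by simp
qed

lemma eq_of_int_dvd_diff:
  fixes u v M :: nat
  assumes "int M dvd int u - int v" "\<bar>int u - int v\<bar> < int M"
  shows   "u = v"
  using assms dvd_imp_le_int[of "int u - int v" "int M"] by auto

text \<open>Write \<open>m\<close> for \<open>n - X * Y\<close>. A solution outside \<open>A\<close>
  and \<open>B\<close> has \<open>X < m\<close> and \<open>X < y\<close>, and lies in
  \<open>C\<close> or \<open>D\<close> according to whether \<open>y \<le> u\<close>. Each of the
  four sets injects into a short interval of naturals.\<close>

lemma card_sols_at_le:
  assumes "a dvd n" "n > 1"
  shows   "finite (sols_at n a)"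
          "real (card (sols_at n a)) \<le> 2 * sqrt n - 3 + 2 * sqrt (a + sqrt n)"
proof -
  \<comment> \<open>Chosen so that \<open>m * y = X + a < u * u\<close>; hence \<open>y > u\<close>
    forces \<open>m \<le> u\<close>.\<close>
  define u where "u = sqrt (a + sqrt n)"
  define K where "K = nat \<lfloor>sqrt n\<rfloor>"
  define U where "U = nat \<lfloor>u\<rfloor>"
  define A where "A = {(X, x, Y, y). (X, x, Y, y) \<in> sols_at n a \<and> n - X * Y \<le> X}"
  define B where "B = {(X, x, Y, y). (X, x, Y, y) \<in> sols_at n a \<and> y \<le> X}"
  define C where "C = {(X, x, Y, y). (X, x, Y, y) \<in> sols_at n a \<and> X < y \<and> real y \<le> u}"
  define D where "D = {(X, x, Y, y). (X, x, Y, y) \<in> sols_at n a \<and> X < n - X * Y \<and> real y > u}"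
  have s1: "sqrt n \<ge> 1" using assms by simp
  have u1: "u \<ge> 1" using s1 unfolding u_def by (simp add: add_increasing)
  have K: "K \<ge> 1" "real K \<le> sqrt n"
    using s1 by (simp_all add: K_def le_nat_iff le_floor_iff)
  have U: "U \<ge> 1" "real U \<le> u"
    using u1 by (simp_all add: U_def le_nat_iff le_floor_iff)
  have XK: "X \<le> K" "real X < sqrt n" if "X * X < n" for X
  proof -
    have "real X ^ 2 < real n"
      using that by (simp add: power2_eq_square flip: of_nat_mult)
    thus "real X < sqrt n"
      by (simp add: real_less_rsqrt)
    thus "X \<le> K"
      by (simp add: K_def le_nat_iff le_floor_iff)
  qed
  obtain b where b: "n = a * b" using assms by auto
  have a0: "a > 0" using assms by (auto intro: Nat.gr0I)
  have by': "b * y = X * x + 1" if "(X, x, Y, y) \<in> sols_at n a" for X x Y y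
  proof -
    have "a * (b * y) = a * (X * x + 1)"
      using sols_atD(7)[OF that] by (simp only: b mult.assoc)
    thus ?thesis
      using a0 by (simp only: nat_mult_eq_cancel1)
  qed

  have injA: "inj_on (\<lambda>(X, x, Y, y). X) A"
  proof (rule inj_onI, clarify, goal_cases)
    case (1 _ x Y y X x' Y' y')
    hence s: "(X, x, Y, y) \<in> sols_at n a" "(X, x', Y', y') \<in> sols_at n a"
      and le: "n - X * Y \<le> X" "n - X * Y' \<le> X" by (auto simp: A_def)
    note d = sols_atD[OF s(1)] sols_atD[OF s(2)]
    \<comment> \<open>Both sides are congruent to \<open>n\<close> modulo \<open>X\<close> and lie
      between 1 and \<open>X\<close>. Then \<open>y\<close> follows from
      \<open>m * y = X + a\<close>.\<close>
    have "n - X * Y = n - X * Y'"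
    proof (rule eq_of_int_dvd_diff)
      show "int X dvd int (n - X * Y) - int (n - X * Y')"
        using d by (auto simp: of_nat_diff intro!: dvd_diff)
      show "\<bar>int (n - X * Y) - int (n - X * Y')\<bar> < int X"
        using le d by linarith
    qed
    hence "(n - X * Y) * y = (n - X * Y) * y'" using d by simp
    hence "y = y'" using d by simp
    thus ?case using sols_at_eqI s 1 by blast
  qed
  have injB: "inj_on (\<lambda>(X, x, Y, y). X) B"
  proof (rule inj_onI, clarify, goal_cases)
    case (1 _ x Y y X x' Y' y')
    hence s: "(X, x, Y, y) \<in> sols_at n a" "(X, x', Y', y') \<in> sols_at n a"
      and le: "y \<le> X" "y' \<le> X" by (auto simp: B_def)
    note d = sols_atD[OF s(1)] sols_atD[OF s(2)]
    have "y = y'"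
    proof (rule eq_of_int_dvd_diff)
      have "int b * int y = int X * int x + 1" "int b * int y' = int X * int x' + 1"
        using by'[OF s(1)] by'[OF s(2)] by (metis of_nat_1 of_nat_add of_nat_mult)+
      hence eq: "int b * (int y - int y') = int X * (int x - int x')"
        and bez: "int b * int y - int X * int x = 1"
        by (simp_all add: algebra_simps)
      \<comment> \<open>The relation \<open>b * y - X * x = 1\<close> makes \<open>b\<close>
        invertible modulo \<open>X\<close>, so \<open>y\<close> is determined modulo
        \<open>X\<close>.\<close>
      have "coprime (int X) (int b)"
      proof (rule coprimeI)
        fix e assume "e dvd int X" "e dvd int b"
        hence "e dvd int b * int y - int X * int x" by simp
        thus "is_unit e" by (simp add: bez)
      qed
      moreover have "int X dvd int b * (int y - int y')"
        unfolding eq by simp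
      ultimately show "int X dvd int y - int y'"
        by (simp add: coprime_dvd_mult_right_iff)
      show "\<bar>int y - int y'\<bar> < int X"
        using le d by linarith
    qed
    thus ?case using sols_at_eqI s 1 by blast
  qed
  have injC: "inj_on (\<lambda>(X, x, Y, y). y) C"
  proof (rule inj_onI, clarify, goal_cases)
    case (1 X x Y _ X' x' Y' y)
    hence s: "(X, x, Y, y) \<in> sols_at n a" "(X', x', Y', y) \<in> sols_at n a"
      and le: "X < y" "X' < y" by (auto simp: C_def)
    \<comment> \<open>Since \<open>y\<close> divides \<open>X + a\<close>, the residue of
      \<open>X\<close> modulo \<open>y\<close> is that of \<open>-a\<close>, and
      \<open>X < y\<close>.\<close>
    have "X = X'"
    proof (rule eq_of_int_dvd_diff)
      have "y dvd X + a" "y dvd X' + a"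
        using sols_atD(9)[OF s(1)] sols_atD(9)[OF s(2)] by (metis dvd_triv_right)+
      hence "int y dvd int (X + a) - int (X' + a)"
        by (intro dvd_diff) (simp_all only: of_nat_dvd_iff)
      thus "int y dvd int X - int X'" by simp
      show "\<bar>int X - int X'\<bar> < int y"
        using le by linarith
    qed
    thus ?case using sols_at_eqI s 1 by blast
  qed
  have injD: "inj_on (\<lambda>(X, x, Y, y). n - X * Y) D"
  proof (rule inj_onI, clarify, goal_cases)
    case (1 X x Y y X' x' Y' y')
    hence s: "(X, x, Y, y) \<in> sols_at n a" "(X', x', Y', y') \<in> sols_at n a"
      and le: "X < n - X * Y" "X' < n - X * Y" and m: "n - X * Y = n - X' * Y'"
      by (auto simp: D_def)
    have e: "(n - X * Y) * y = X + a" "(n - X * Y) * y' = X' + a"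
      using sols_atD(9)[OF s(1)] sols_atD(9)[OF s(2)] m by simp_all
    \<comment> \<open>The same argument with the other factor \<open>m\<close> of
      \<open>X + a\<close> as modulus.\<close>
    have "X = X'"
    proof (rule eq_of_int_dvd_diff)
      have "n - X * Y dvd X + a" "n - X * Y dvd X' + a"
        using e by (metis dvd_triv_left)+
      hence "int (n - X * Y) dvd int (X + a) - int (X' + a)"
        by (intro dvd_diff) (simp_all only: of_nat_dvd_iff)
      thus "int (n - X * Y) dvd int X - int X'" by simp
      show "\<bar>int X - int X'\<bar> < int (n - X * Y)"
        using le by linarith
    qed
    moreover from this have "y = y'"
      using e le by (metis mult_left_cancel not_less_zero)
    ultimately show ?case using sols_at_eqI s by blast
  qed

  have ran: "X \<ge> 1" "X \<le> K" "y \<ge> 2" if "(X, x, Y, y) \<in> sols_at n a" for X x Y y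
    using sols_atD(1,4,5)[OF that] XK(1)[of X] by simp_all
  have imA: "(\<lambda>(X, x, Y, y). X) ` A \<subseteq> {1..K}"
    using ran by (fastforce simp: A_def)
  \<comment> \<open>The interval starts at 2 because \<open>2 \<le> y \<le> X\<close>; so do those
    for \<open>C\<close> (as \<open>y > 1\<close>) and \<open>D\<close> (as
    \<open>m > X \<ge> 1\<close>). These three savings are the \<open>- 3\<close> in the
    bound.\<close>
  have imB: "(\<lambda>(X, x, Y, y). X) ` B \<subseteq> {2..K}"
    using ran by (fastforce simp: B_def)
  have imC: "(\<lambda>(X, x, Y, y). y) ` C \<subseteq> {2..U}"
    by (auto simp: C_def U_def le_nat_iff le_floor_iff dest: sols_atD(4))
  have imD: "(\<lambda>(X, x, Y, y). n - X * Y) ` D \<subseteq> {2..U}"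
  proof (clarify, goal_cases)
    case (1 _ X x Y y)
    hence s: "(X, x, Y, y) \<in> sols_at n a" and le: "X < n - X * Y" "real y > u"
      by (auto simp: D_def)
    note d = sols_atD[OF s]
    have "real (n - X * Y) * real y = real X + real a"
      using d(9) by (metis of_nat_add of_nat_mult)
    also have "\<dots> < u * u"
      using XK(2)[OF d(5)] by (simp add: u_def)
    finally have "real (n - X * Y) * real y < u * u" .
    moreover have "u * u \<le> real (n - X * Y) * real y" if "u \<le> real (n - X * Y)"
      using that le u1 by (intro mult_mono) auto
    ultimately have "real (n - X * Y) \<le> u" by linarith
    moreover have "n - X * Y \<ge> 2" using le d(1) by linarith
    ultimately show ?case
      by (simp add: U_def le_nat_iff le_floor_iff del: of_nat_diff)
  qed

  have fin: "finite A" "finite B" "finite C" "finite D"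
    using inj_on_finite[OF injA imA] inj_on_finite[OF injB imB]
      inj_on_finite[OF injC imC] inj_on_finite[OF injD imD] by simp_all
  have cards: "card A \<le> K" "card B \<le> K - 1" "card C \<le> U - 1" "card D \<le> U - 1"
    using card_inj_on_le[OF injA imA] card_inj_on_le[OF injB imB]
      card_inj_on_le[OF injC imC] card_inj_on_le[OF injD imD] by simp_all
  have sub: "sols_at n a \<subseteq> A \<union> B \<union> C \<union> D"
    by (auto simp: A_def B_def C_def D_def)
  show "finite (sols_at n a)"
    using sub fin by (meson finite_UnI finite_subset)
  have "card (sols_at n a) \<le> card (A \<union> B \<union> C \<union> D)"
    using sub fin by (intro card_mono) auto
  also have "\<dots> \<le> card A + card B + card C + card D"
    by (meson card_Un_le add_le_mono1 order_trans)
  also have "\<dots> \<le> K + (K - 1) + (U - 1) + (U - 1)"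
    using cards by linarith
  finally have "real (card (sols_at n a)) \<le> 2 * real K - 3 + 2 * real U"
    using K(1) U(1) by linarith
  thus "real (card (sols_at n a)) \<le> 2 * sqrt n - 3 + 2 * sqrt (a + sqrt n)"
    using K(2) U(2) unfolding u_def by linarith
qed

subsection \<open>Counting all solutions\<close>

text \<open>Every class has a representative with \<open>X * X < n\<close>: as
  \<open>X * Y < n\<close>, the smaller of \<open>X\<close> and \<open>Y\<close> has square below
  \<open>n\<close>, and transposing puts it first.\<close>

lemma f_le_sum_sols_at:
  assumes "n > 1"
  shows   "f n \<le> (\<Sum>a | a dvd n. card (sols_at n a))"
proof -
  define S where "S = {(X, x, Y, y). (X, x, Y, y) \<in> solutions n \<and> X * X < n}"
  have cls: "same_solution n `` {s} = {s, transpose_pairs s}" if "s \<in> solutions n" for s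
    using that by (auto simp: same_solution_def)
  have fin: "finite {a. a dvd n}"
    using assms by simp
  have sub: "S \<subseteq> (\<Union>a\<in>{a. a dvd n}. sols_at n a)"
    using ex_sols_at by (fastforce simp: S_def)
  have finU: "finite (\<Union>a\<in>{a. a dvd n}. sols_at n a)"
    using fin card_sols_at_le(1) assms by blast
  have "solutions n // same_solution n \<subseteq> (\<lambda>s. same_solution n `` {s}) ` S"
  proof
    fix c assume "c \<in> solutions n // same_solution n"
    then obtain X x Y y where s: "(X, x, Y, y) \<in> solutions n"
        and c: "c = same_solution n `` {(X, x, Y, y)}"
      by (auto elim!: quotientE)
    have s': "(Y, y, X, x) \<in> solutions n"
      using s transpose_pairs_in_solutions[of "(X, x, Y, y)" n] by simp
    have c': "c = same_solution n `` {(Y, y, X, x)}"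
      using s s' c by (auto simp: cls)
    have pos: "x * y > 0"
      using s by (auto simp: solutions_def)
    have "X * Y * (x * y) < (X * x + 1) * (Y * y + 1)"
      by (simp add: algebra_simps)
    hence "X * Y < n"
      unfolding solutions_nat_eq[OF s, symmetric] using pos by simp
    moreover have "X * X \<le> X * Y \<or> Y * Y \<le> X * Y"
      by (metis mult_le_mono1 mult_le_mono2 nat_le_linear)
    ultimately have "X * X < n \<or> Y * Y < n"
      by linarith
    thus "c \<in> (\<lambda>s. same_solution n `` {s}) ` S"
      using s s' c c' by (auto simp: S_def)
  qed
  hence "f n \<le> card S"
    unfolding f_def using sub finU by (intro surj_card_le) (auto intro: finite_subset)
  also have "\<dots> \<le> card (\<Union>a\<in>{a. a dvd n}. sols_at n a)"
    using sub finU by (rule card_mono[rotated])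
  also have "\<dots> \<le> (\<Sum>a | a dvd n. card (sols_at n a))"
    using fin by (rule card_UN_le)
  finally show ?thesis .
qed

text \<open>For fixed \<open>a * b = n\<close>, the square of the left side grows with
  \<open>a + b\<close>, and \<open>(a - 1) * (b - 1) \<ge> 0\<close> gives
  \<open>a + b \<le> n + 1\<close>. So the extreme case is that of the factors 1 and
  \<open>n\<close>.\<close>

lemma sqrt_add_sqrt_le:
  fixes a b :: real
  assumes "a \<ge> 1" "b \<ge> 1" "n = a * b"
  shows   "sqrt (a + sqrt n) + sqrt (b + sqrt n) \<le> 5 / 4 * sqrt n + 7 / 4"
proof -
  define s where "s = sqrt n"
  have n: "n \<ge> 1" using assms mult_mono[of 1 a 1 b] by simp
  have s: "s \<ge> 1" "n = s * s" using n by (simp_all add: s_def)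
  have "(a - 1) * (b - 1) \<ge> 0" using assms by simp
  hence ab: "a + b \<le> n + 1" using assms by (simp add: algebra_simps)
  have "(a + s) * (b + s) \<le> (n + s) * (1 + s)"
  proof -
    have "(a + s) * (b + s) = n + s * (a + b) + s * s"
      by (simp add: assms algebra_simps)
    also have "\<dots> \<le> n + s * (n + 1) + s * s"
      using ab s by simp
    finally show ?thesis by (simp add: algebra_simps)
  qed
  hence le: "sqrt (a + s) * sqrt (b + s) \<le> sqrt (n + s) * sqrt (1 + s)"
    by (simp flip: real_sqrt_mult)
  have "(sqrt (a + s) + sqrt (b + s))\<^sup>2 \<le> (sqrt (n + s) + sqrt (1 + s))\<^sup>2"
    using le ab assms s n by (simp add: power2_sum)
  hence "sqrt (a + s) + sqrt (b + s) \<le> sqrt (n + s) + sqrt (1 + s)"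
    by (rule power2_le_imp_le) (use s n in auto)
  also have "sqrt (n + s) \<le> s + 1 / 2"
    by (rule real_le_lsqrt) (use s in \<open>auto simp: power2_eq_square algebra_simps\<close>)
  \<comment> \<open>The right side is the tangent to the concave left side at
    \<open>s = 3\<close>.\<close>
  also have "sqrt (1 + s) \<le> s / 4 + 5 / 4"
  proof (rule real_le_lsqrt)
    have "(s / 4 + 5 / 4)\<^sup>2 - (1 + s) = ((s - 3) / 4)\<^sup>2"
      by (simp add: power2_eq_square field_simps)
    thus "1 + s \<le> (s / 4 + 5 / 4)\<^sup>2"
      by (metis diff_ge_0_iff_ge zero_le_power2)
  qed (use s in auto)
  finally show ?thesis by (simp add: s_def)
qed

text \<open>The bound for one \<open>a\<close> varies with \<open>a\<close>, so it is averaged over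
  the involution that takes \<open>a\<close> to \<open>n div a\<close>. The pair bound is
  \<open>4 * sqrt n - 6\<close> plus twice that of \<open>sqrt_add_sqrt_le\<close>.\<close>

lemma f_le_\<theta>_sqrt:
  assumes "n > 1"
  shows   "real (f n) \<le> 1 / 2 * real (\<theta> n) * (13 / 2 * sqrt n - 5 / 2)"
proof -
  define h where "h = (\<lambda>a::nat. 2 * sqrt n - 3 + 2 * sqrt (a + sqrt n))"
  have swap: "(\<Sum>a | a dvd n. h a) = (\<Sum>a | a dvd n. h (n div a))"
    using assms by (intro sum.reindex_bij_witness[of _ "\<lambda>a. n div a" "\<lambda>a. n div a"])
      (auto simp: dvd_div_eq_mult elim!: dvdE)
  have pair: "h a + h (n div a) \<le> 13 / 2 * sqrt n - 5 / 2" if a: "a dvd n" for a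
  proof -
    obtain b where b: "n = a * b" using a by blast
    have "a > 0" "b > 0" using b assms by (auto intro: Nat.gr0I)
    thus ?thesis
      using sqrt_add_sqrt_le[of "real a" "real b" "real n"] b by (simp add: h_def)
  qed
  have "real (f n) \<le> (\<Sum>a | a dvd n. real (card (sols_at n a)))"
    using f_le_sum_sols_at[OF assms] by (metis of_nat_le_iff of_nat_sum)
  also have "\<dots> \<le> (\<Sum>a | a dvd n. h a)"
    using card_sols_at_le(2) assms by (intro sum_mono) (auto simp: h_def)
  also have "\<dots> = 1 / 2 * (\<Sum>a | a dvd n. h a + h (n div a))"
    using swap by (simp add: sum.distrib)
  also have "(\<Sum>a | a dvd n. h a + h (n div a)) \<le> (\<Sum>a | a dvd n. 13 / 2 * sqrt n - 5 / 2)"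
    using pair by (intro sum_mono) auto
  also have "\<dots> = real (\<theta> n) * (13 / 2 * sqrt n - 5 / 2)"
    by (simp add: \<theta>_def)
  finally show ?thesis by simp
qed

text \<open>Because \<open>\<alpha> * s \<ge> 1\<close>, the last term of \<open>g\<close> is at
  least \<open>2 * \<alpha> * s\<close>. What remains after division by \<open>s\<close> and
  multiplication by \<open>\<alpha>\<close> is a quadratic inequality in
  \<open>\<alpha>\<close>.\<close>

lemma g_ge:
  fixes \<alpha> :: real
  assumes "n > 1" "1 \<le> \<alpha>" "\<alpha> \<le> sqrt n"
  shows   "13 / 2 * sqrt n - 5 / 2 \<le> g n \<alpha>" "0 \<le> g n \<alpha>"
proof -
  define s where "s = sqrt n"
  have s: "s \<ge> 1" "real n = s * s" using assms by (simp_all add: s_def)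
  have "\<alpha> \<le> s" using assms by (simp add: s_def)
  hence den: "2 * s - \<alpha> > 0" using assms s(1) by linarith
  have as: "1 \<le> \<alpha> * s" using assms(2) s(1) mult_mono[of 1 \<alpha> 1 s] by simp
  have "2 * \<alpha> * s * (2 * s - \<alpha>) \<le> 2 * (2 * real n - 1) * \<alpha>"
  proof -
    have "2 * \<alpha> * s * (2 * s - \<alpha>) = \<alpha> * (4 * (s * s) - 2 * (\<alpha> * s))"
      by (simp add: algebra_simps)
    also have "\<dots> \<le> \<alpha> * (4 * (s * s) - 2)"
      using as assms by (intro mult_left_mono) auto
    finally show ?thesis by (simp add: s(2) algebra_simps)
  qed
  hence last: "2 * \<alpha> * s \<le> 2 * (2 * real n - 1) * \<alpha> / (2 * s - \<alpha>)"
    using den by (simp add: pos_le_divide_eq)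
  have g: "g n \<alpha> \<ge> s * ((ln n + 1.2) / \<alpha> + 2 + 2 * \<alpha>)"
  proof -
    have "s * ((ln n + 1.2) / \<alpha> + 2 + 2 * \<alpha>)
        = 1 / \<alpha> * s * ln n + 2 * (1 + 0.6 / \<alpha>) * s + 2 * \<alpha> * s"
      by (simp add: algebra_simps add_divide_distrib)
    with last show ?thesis
      unfolding g_def s_def[symmetric] by linarith
  qed
  have main: "s * (c + 2) \<le> g n \<alpha>" if "c * \<alpha> \<le> ln n + 1.2 + 2 * \<alpha> * \<alpha>" for c
  proof -
    have "c \<le> (ln n + 1.2) / \<alpha> + 2 * \<alpha>"
      using that assms by (simp add: field_simps)
    hence "s * (c + 2) \<le> s * ((ln n + 1.2) / \<alpha> + 2 + 2 * \<alpha>)"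
      using s by (intro mult_left_mono) auto
    with g show ?thesis by linarith
  qed
  have "13 / 2 * s - 5 / 2 \<le> g n \<alpha>"
  proof (cases "n \<ge> 4")
    case True
    have "ln (real n) \<ge> ln 4" using True by simp
    also have "ln (4::real) = 2 * ln 2"
      using ln_realpow[of "2::real" 2] by simp
    finally have "ln (real n) \<ge> 4 / 3"
      using ln2_ge_two_thirds by linarith
    \<comment> \<open>Completing the square for \<open>c = 9 / 2\<close>, which makes
      \<open>c + 2\<close> equal to \<open>13 / 2\<close>. The remainder \<open>81 / 32\<close> is
      just below \<open>4 / 3 + 1.2\<close>.\<close>
    moreover have "0 \<le> 2 * (\<alpha> - 9 / 8)\<^sup>2" by simp
    hence "9 / 2 * \<alpha> \<le> 81 / 32 + 2 * \<alpha> * \<alpha>"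
      by (simp add: power2_eq_square algebra_simps)
    ultimately have "9 / 2 * \<alpha> \<le> ln n + 1.2 + 2 * \<alpha> * \<alpha>" by simp
    from main[OF this] show ?thesis by simp
  next
    case False
    have "s \<le> sqrt 3" using False by (simp add: s_def)
    also have "sqrt 3 \<le> (19 / 10 :: real)"
      by (rule real_le_lsqrt) (auto simp: power2_eq_square)
    finally have s19: "s \<le> 19 / 10" .
    \<comment> \<open>For \<open>n < 4\<close> the smaller \<open>c = 32 / 10\<close> suffices:
      \<open>5.2 * s\<close> exceeds \<open>6.5 * s - 2.5\<close> as long as
      \<open>s \<le> 25 / 13\<close>, and \<open>s \<le> 1.9\<close>. Here the term
      \<open>- 5 / 2\<close> is used.\<close>
    have "0 \<le> (\<alpha> - 1) * (2 * \<alpha> - 12 / 10)"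
      using assms by (intro mult_nonneg_nonneg) auto
    also have "\<dots> = 2 * \<alpha> * \<alpha> - 32 / 10 * \<alpha> + 12 / 10"
      by (simp add: field_simps)
    finally have "32 / 10 * \<alpha> \<le> 12 / 10 + 2 * \<alpha> * \<alpha>"
      by linarith
    moreover have "ln (real n) \<ge> 0" using assms by simp
    ultimately have "32 / 10 * \<alpha> \<le> ln n + 1.2 + 2 * \<alpha> * \<alpha>"
      by simp
    from main[OF this] s19 show ?thesis by simp
  qed
  thus "13 / 2 * sqrt n - 5 / 2 \<le> g n \<alpha>" by (simp add: s_def)
  with s show "0 \<le> g n \<alpha>" unfolding s_def by linarith
qed

theorem theorem3:
  shows "(\<forall>\<epsilon>::real. \<epsilon> > 0 \<longrightarrow> (\<exists>C::real. \<forall>(n::nat) (\<alpha>::real).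
            n > 1 \<and> 1 \<le> \<alpha> \<and> \<alpha> \<le> sqrt (real n) \<longrightarrow>
            (\<not> is_square n \<longrightarrow>
               real (f n) \<le> 1 / 2 * real (\<theta> n) * g n \<alpha> \<and>
               1 / 2 * real (\<theta> n) * g n \<alpha> \<le>
                 C * real n powr \<epsilon> *
                   (1 / (2 * \<alpha>) * sqrt (real n) * ln (real n) + (1 + 0.6 / \<alpha>) * sqrt (real n)
                     + (2 * real n - 1) * \<alpha> / (2 * sqrt (real n) - \<alpha>))) \<and>
            (is_square n \<longrightarrow>
               real (f n) \<le> 1 / 2 * (real (\<theta> n) + 1) * g n \<alpha> \<and>
               1 / 2 * (real (\<theta> n) + 1) * g n \<alpha> \<le>
                 (C * real n powr \<epsilon> + 1) *
                   (1 / (2 * \<alpha>) * sqrt (real n) * ln (real n) + (1 + 0.6 / \<alpha>) * sqrt (real n)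
                     + (2 * real n - 1) * \<alpha> / (2 * sqrt (real n) - \<alpha>)))))
         \<and> (\<forall>\<^sub>F n in sequentially. f n < n)"
proof (intro conjI allI impI)
  fix \<epsilon> :: real assume "\<epsilon> > 0"
  then obtain C where C: "\<And>n. n > 0 \<Longrightarrow> real (\<theta> n) \<le> C * real n powr \<epsilon>"
    using \<theta>_le_powr by blast
  define br where "br n \<alpha> = 1 / (2 * \<alpha>) * sqrt (real n) * ln (real n) + (1 + 0.6 / \<alpha>) * sqrt (real n)
                     + (2 * real n - 1) * \<alpha> / (2 * sqrt (real n) - \<alpha>)" for n \<alpha>
  \<comment> \<open>With this, the upper estimates are the divisor bound multiplied by the
    nonnegative \<open>br n \<alpha>\<close>.\<close>
  have g: "g n \<alpha> = 2 * br n \<alpha>" for n \<alpha>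
    unfolding g_def br_def by (simp add: algebra_simps add_divide_distrib diff_divide_distrib)
  have nonneg: "0 \<le> br n \<alpha>" and fle: "real (f n) \<le> 1 / 2 * real (\<theta> n) * g n \<alpha>"
    if "n > 1 \<and> 1 \<le> \<alpha> \<and> \<alpha> \<le> sqrt (real n)" for n \<alpha>
  proof -
    show "0 \<le> br n \<alpha>"
      using g_ge(2) that by (simp add: g)
    have "1 / 2 * real (\<theta> n) * (13 / 2 * sqrt n - 5 / 2) \<le> 1 / 2 * real (\<theta> n) * g n \<alpha>"
      using g_ge(1) that by (intro mult_left_mono) auto
    thus "real (f n) \<le> 1 / 2 * real (\<theta> n) * g n \<alpha>"
      using f_le_\<theta>_sqrt[of n] that by linarith
  qed
  show "\<exists>C::real. \<forall>(n::nat) (\<alpha>::real).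
            n > 1 \<and> 1 \<le> \<alpha> \<and> \<alpha> \<le> sqrt (real n) \<longrightarrow>
            (\<not> is_square n \<longrightarrow>
               real (f n) \<le> 1 / 2 * real (\<theta> n) * g n \<alpha> \<and>
               1 / 2 * real (\<theta> n) * g n \<alpha> \<le>
                 C * real n powr \<epsilon> *
                   (1 / (2 * \<alpha>) * sqrt (real n) * ln (real n) + (1 + 0.6 / \<alpha>) * sqrt (real n)
                     + (2 * real n - 1) * \<alpha> / (2 * sqrt (real n) - \<alpha>))) \<and>
            (is_square n \<longrightarrow>
               real (f n) \<le> 1 / 2 * (real (\<theta> n) + 1) * g n \<alpha> \<and>
               1 / 2 * (real (\<theta> n) + 1) * g n \<alpha> \<le>
                 (C * real n powr \<epsilon> + 1) *
                   (1 / (2 * \<alpha>) * sqrt (real n) * ln (real n) + (1 + 0.6 / \<alpha>) * sqrt (real n)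
                     + (2 * real n - 1) * \<alpha> / (2 * sqrt (real n) - \<alpha>)))"
    unfolding br_def[symmetric]
  proof (intro exI[of _ C] allI impI conjI)
    fix n :: nat and \<alpha> :: real
    assume A: "n > 1 \<and> 1 \<le> \<alpha> \<and> \<alpha> \<le> sqrt (real n)"
    show "real (f n) \<le> 1 / 2 * real (\<theta> n) * g n \<alpha>"
      by (rule fle[OF A])
    \<comment> \<open>The bound for squares is the previous one plus half of the nonnegative
      \<open>g n \<alpha>\<close>.\<close>
    thus "real (f n) \<le> 1 / 2 * (real (\<theta> n) + 1) * g n \<alpha>"
      using nonneg[OF A] by (simp add: g algebra_simps)
    show "1 / 2 * real (\<theta> n) * g n \<alpha> \<le> C * real n powr \<epsilon> * br n \<alpha>"
      using mult_right_mono[OF C[of n] nonneg[OF A]] A by (simp add: g)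
    thus "1 / 2 * (real (\<theta> n) + 1) * g n \<alpha> \<le> (C * real n powr \<epsilon> + 1) * br n \<alpha>"
      by (simp add: g algebra_simps)
  qed
next
  \<comment> \<open>Any exponent below \<open>1 / 2\<close> would serve. With \<open>1 / 4\<close>
    and \<open>t = n powr (1 / 4)\<close>, the bound on \<open>f n\<close> becomes
    \<open>13 / 4 * C * t ^ 3\<close>, which is below \<open>n = t ^ 4\<close> once
    \<open>t > 13 / 4 * C\<close>.\<close>
  obtain C where C: "C > 0" "\<And>n. n > 0 \<Longrightarrow> real (\<theta> n) \<le> C * real n powr (1 / 4)"
    using \<theta>_le_powr[of "1 / 4"] by auto
  have "\<forall>\<^sub>F n in sequentially. n > max 1 (nat \<lceil>(13 / 4 * C) ^ 4\<rceil>)"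
    by (rule eventually_gt_at_top)
  thus "\<forall>\<^sub>F n in sequentially. f n < n"
  proof eventually_elim
    case (elim n)
    hence n: "n > 1" "(13 / 4 * C) ^ 4 < real n"
      using real_nat_ceiling_ge[of "(13 / 4 * C) ^ 4"] by (simp_all, linarith)
    define t where "t = real n powr (1 / 4)"
    have t: "t > 0" "t ^ 4 = real n" "sqrt n = t ^ 2"
      using n by (simp_all add: t_def powr_half_sqrt[symmetric] powr_powr flip: powr_realpow)
    have "13 / 4 * C < t"
      using n(2) t by (metis less_imp_le power_less_imp_less_base)
    have "real (f n) \<le> 1 / 2 * real (\<theta> n) * (13 / 2 * t ^ 2 - 5 / 2)"
      using f_le_\<theta>_sqrt[OF n(1)] t by simp
    also have "\<dots> \<le> 1 / 2 * real (\<theta> n) * (13 / 2 * t ^ 2)"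
      by (intro mult_left_mono) auto
    also have "\<dots> \<le> 1 / 2 * (C * t) * (13 / 2 * t ^ 2)"
      using C(2)[of n] n t by (intro mult_right_mono mult_left_mono) (auto simp: t_def)
    also have "\<dots> = 13 / 4 * C * t ^ 3"
      by (simp add: power2_eq_square power3_eq_cube)
    also have "\<dots> < t * t ^ 3"
      using \<open>13 / 4 * C < t\<close> t by (intro mult_strict_right_mono) auto
    also have "\<dots> = real n"
      using t by (simp flip: power_Suc)
    finally show ?case by simp
  qed
qed

end
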